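(* Let $(M,p_0)$ be a based metric space that is Lipschitz path connected and has more than one element, and suppose that the universal path space $\mathcal{P}_M$ with its lifted pseudo-metric $d_{\mathcal{P}}$ is a metric space. Then $\mathcal{P}_M$ is a length space.
   Context: All paths and loops are Lipschitz with domain $I=[0,1]$ (Euclidean metric); $\ell(\gamma)$ is the length of $\gamma$, $\overline{\gamma}$ the inverse path, $*$ concatenation. A metric space is Lipschitz path connected if any two points are joined by a Lipschitz path. $I\times I$ carries the $L^1$ metric. Two paths $\gamma,\gamma'$ in $M$ with the same initial points and the same end points are homotopic rel endpoints, $\gamma\simeq\gamma'$, if there is a Lipschitz map $H:I\times I\to M$ with $H|_{I\times\{0\}}=\gamma$, $H|_{I\times\{1\}}=\gamma'$, $H|_{\{0\}\times I}\equiv\gamma(0)$, $H|_{\{1\}\times I}\equiv\gamma(1)$; $[\gamma]$ denotes the class of $\gamma$. The universal (Lipschitz) path space of $(M,p_0)$ is $\mathcal{P}_M=\{[\gamma] : \gamma:I\to M \text{ Lipschitz},\ \gamma(0)=p_0\}$, with base point $[p_0]$ (the class of the constant loop) and lifted pseudo-metric $d_{\mathcal{P}}([\gamma_1],[\gamma_2])=\inf\{\ell(\beta):\beta\simeq\overline{\gamma_1}*\gamma_2\}$. A metric space $(X,d)$ is a length space if for every $C>1$ any $x_1,x_2\in X$ are joined by a Lipschitz path $\gamma$ with $\ell(\gamma)\le C\,d(x_1,x_2)$; equivalently $d(x_1,x_2)$ is the infimum of the lengths of Lipschitz paths joining $x_1$ to $x_2$. *)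

theory Defs
  imports "HOL-Analysis.Abstract_Metric_Spaces"
begin

text \<open>
  Metric spaces are elements of the library type of abstract metrics (a carrier set together
  with a distance), because the path space below is a metric space on a set of equivalence
  classes and not on a type. Paths are total functions on the reals of which only the values
  on the unit interval matter; all notions below respect this.
\<close>

definition unit_interval :: "real metric" where
  "unit_interval = submetric euclidean_metric {0..1}"

definition unit_square :: "(real \<times> real) metric" where
  "unit_square = metric ({0..1} \<times> {0..1}, \<lambda>(s, t) (s', t'). \<bar>s - s'\<bar> + \<bar>t - t'\<bar>)"

lemma mspace_unit_interval [simp]: "mspace unit_interval = {0..1}"
  and mdist_unit_interval [simp]: "mdist unit_interval s t = \<bar>s - t\<bar>"
  by (simp_all add: unit_interval_def dist_real_def)

interpretation unit_square:
  Metric_space "{0..1} \<times> {0..1}" "\<lambda>(s, t) (s', t'). \<bar>s - s'\<bar> + \<bar>t - t' :: real\<bar>"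
  by unfold_locales auto

lemma mspace_unit_square [simp]: "mspace unit_square = {0..1} \<times> {0..1}"
  and mdist_unit_square [simp]: "mdist unit_square (s, t) (s', t') = \<bar>s - s'\<bar> + \<bar>t - t'\<bar>"
  by (simp_all add: unit_square_def)

definition lip_path :: "'a metric \<Rightarrow> (real \<Rightarrow> 'a) \<Rightarrow> bool" where
  "lip_path m \<gamma> \<longleftrightarrow> Lipschitz_continuous_map unit_interval m \<gamma>"

definition lip_path_connected :: "'a metric \<Rightarrow> bool" where
  "lip_path_connected m \<longleftrightarrow>
     (\<forall>x\<in>mspace m. \<forall>y\<in>mspace m. \<exists>\<gamma>. lip_path m \<gamma> \<and> \<gamma> 0 = x \<and> \<gamma> 1 = y)"

text \<open>
  The supremum over all subdivisions of the unit interval. For a Lipschitz path these sums are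
  bounded by any Lipschitz constant, so the real-valued supremum is the true length; it is only
  used for Lipschitz paths.
\<close>
definition path_length :: "'a metric \<Rightarrow> (real \<Rightarrow> 'a) \<Rightarrow> real" where
  "path_length m \<gamma> =
     Sup {\<Sum>i<n. mdist m (\<gamma> (t i)) (\<gamma> (t (Suc i))) | n t.
            mono_on {..n} t \<and> t 0 = 0 \<and> t n = 1}"

text \<open>
  The library operations \<open>reversepath\<close> and \<open>joinpaths\<close> demand a topological type class on the
  codomain; these are the same formulas without it.
\<close>
definition rev_path :: "(real \<Rightarrow> 'a) \<Rightarrow> real \<Rightarrow> 'a" where
  "rev_path \<gamma> = (\<lambda>s. \<gamma> (1 - s))"

definition join_path :: "(real \<Rightarrow> 'a) \<Rightarrow> (real \<Rightarrow> 'a) \<Rightarrow> real \<Rightarrow> 'a" where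
  "join_path \<gamma> \<gamma>' = (\<lambda>s. if s \<le> 1/2 then \<gamma> (2 * s) else \<gamma>' (2 * s - 1))"

definition lip_homotopic :: "'a metric \<Rightarrow> (real \<Rightarrow> 'a) \<Rightarrow> (real \<Rightarrow> 'a) \<Rightarrow> bool" where
  "lip_homotopic m \<gamma> \<gamma>' \<longleftrightarrow>
     lip_path m \<gamma> \<and> lip_path m \<gamma>' \<and> \<gamma> 0 = \<gamma>' 0 \<and> \<gamma> 1 = \<gamma>' 1 \<and>
     (\<exists>H. Lipschitz_continuous_map unit_square m H \<and>
          (\<forall>s\<in>{0..1}. H (s, 0) = \<gamma> s) \<and> (\<forall>s\<in>{0..1}. H (s, 1) = \<gamma>' s) \<and>
          (\<forall>t\<in>{0..1}. H (0, t) = \<gamma> 0) \<and> (\<forall>t\<in>{0..1}. H (1, t) = \<gamma> 1))"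

definition homotopy_class :: "'a metric \<Rightarrow> (real \<Rightarrow> 'a) \<Rightarrow> (real \<Rightarrow> 'a) set" where
  "homotopy_class m \<gamma> = {\<gamma>'. lip_homotopic m \<gamma> \<gamma>'}"

definition path_space :: "'a metric \<Rightarrow> 'a \<Rightarrow> (real \<Rightarrow> 'a) set set" where
  "path_space m p\<^sub>0 = {homotopy_class m \<gamma> | \<gamma>. lip_path m \<gamma> \<and> \<gamma> 0 = p\<^sub>0}"

text \<open>
  The infimum ranges over all representatives of the two classes; since the class of the
  concatenation does not depend on them, this is the infimum for any fixed pair of
  representatives. The value off the carrier is set to \<open>0\<close> because \<^locale>\<open>Metric_space\<close> requires
  the distance to be nonnegative and symmetric on the whole type.
\<close>
definition path_space_dist ::
  "'a metric \<Rightarrow> 'a \<Rightarrow> (real \<Rightarrow> 'a) set \<Rightarrow> (real \<Rightarrow> 'a) set \<Rightarrow> real" where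
  "path_space_dist m p\<^sub>0 c\<^sub>1 c\<^sub>2 =
     (if c\<^sub>1 \<in> path_space m p\<^sub>0 \<and> c\<^sub>2 \<in> path_space m p\<^sub>0
      then Inf {path_length m \<beta> | \<beta> \<gamma>\<^sub>1 \<gamma>\<^sub>2.
                  \<gamma>\<^sub>1 \<in> c\<^sub>1 \<and> \<gamma>\<^sub>2 \<in> c\<^sub>2 \<and> lip_homotopic m \<beta> (join_path (rev_path \<gamma>\<^sub>1) \<gamma>\<^sub>2)}
      else 0)"

definition length_space :: "'a metric \<Rightarrow> bool" where
  "length_space m \<longleftrightarrow>
     (\<forall>C>1. \<forall>x\<in>mspace m. \<forall>y\<in>mspace m.
        \<exists>\<gamma>. lip_path m \<gamma> \<and> \<gamma> 0 = x \<and> \<gamma> 1 = y \<and> path_length m \<gamma> \<le> C * mdist m x y)"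

end

theory Submission
  imports Defs "HOL-Analysis.Path_Connected"
begin

text \<open>
  A curve in \<open>M\<close> lifts to the path space without gaining length. Let \<open>\<alpha>\<close> start at the base point
  and let \<open>\<beta>\<close> start where \<open>\<alpha>\<close> ends. Put \<open>\<delta> = \<alpha> * \<beta>\<close> and let \<open>\<Gamma> s\<close> be the class of the initial
  piece of \<open>\<delta>\<close> that runs through \<open>\<alpha>\<close> and then through \<open>\<beta>\<close> up to time \<open>s\<close>. Travelling back along
  \<open>\<Gamma> a\<close> and forth along \<open>\<Gamma> b\<close> is homotopic to the piece of \<open>\<beta>\<close> between \<open>a\<close> and \<open>b\<close>, so the
  distance of \<open>\<Gamma> a\<close> and \<open>\<Gamma> b\<close> is at most the length of that piece. Lengths of consecutive pieces
  add up to at most the length of \<open>\<beta>\<close>; hence \<open>\<Gamma>\<close> is Lipschitz and no longer than \<open>\<beta>\<close>. It joins the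
  class of \<open>\<alpha>\<close> to the class of \<open>\<alpha> * \<beta>\<close> (\<open>lift_path\<close>).

  Given two distinct points of the path space, their distance is positive, so some competitor
  \<open>\<beta>\<close>, homotopic to the inverse of \<open>\<gamma>\<^sub>1\<close> followed by \<open>\<gamma>\<^sub>2\<close>, is shorter than \<open>C\<close> times the distance. Its
  lift starting at the class of \<open>\<gamma>\<^sub>1\<close> ends at the class of \<open>\<gamma>\<^sub>1 * \<beta>\<close>, which is the class of
  \<open>\<gamma>\<^sub>2\<close>. That the path space is a metric space enters for points at distance zero: they coincide, and
  a constant path joins them.

  All homotopies come from three sources: two paths factoring through one path \<open>\<delta>\<close> by
  parameter changes with common ends are homotopic, by interpolating the parameters
  (\<open>lip_homotopic_reparam\<close>); homotopies can be stacked; and they can be placed side by side. The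
  last two both rest on gluing Lipschitz maps of squares along an edge (\<open>Lipschitz_square_join\<close>).
\<close>

section \<open>Gluing and reparametrizing Lipschitz maps\<close>

lemma Lipschitz_squareI:
  assumes "\<And>s t. s \<in> {0..1} \<Longrightarrow> t \<in> {0..1} \<Longrightarrow> f (s, t) \<in> mspace m"
    and "\<And>s t s' t'. s \<in> {0..1} \<Longrightarrow> t \<in> {0..1} \<Longrightarrow> s' \<in> {0..1} \<Longrightarrow> t' \<in> {0..1} \<Longrightarrow>
           mdist m (f (s, t)) (f (s', t')) \<le> D * (\<bar>s - s'\<bar> + \<bar>t - t'\<bar>)"
  shows "Lipschitz_continuous_map unit_square m f"
  unfolding Lipschitz_continuous_map_def using assms by (auto intro!: exI[of _ D])

text \<open>
  Two points on different sides of the common edge are compared through the point of the edge with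
  the second coordinate of the first one; in the \<open>L\<^sup>1\<close> metric this detour costs nothing.
  The factor \<open>2\<close> in the Lipschitz constant comes from the doubled speed.
\<close>
lemma Lipschitz_square_join:
  assumes F: "Lipschitz_continuous_map unit_square m F"
    and G: "Lipschitz_continuous_map unit_square m G"
    and match: "\<And>t. t \<in> {0..1} \<Longrightarrow> F (1, t) = G (0, t)"
  shows "Lipschitz_continuous_map unit_square m
           (\<lambda>(s, t). join_path (\<lambda>s. F (s, t)) (\<lambda>s. G (s, t)) s)"
    (is "Lipschitz_continuous_map _ _ ?H")
proof -
  obtain B where "B > 0" and "F \<in> {0..1} \<times> {0..1} \<rightarrow> mspace m"
    and B: "\<forall>p\<in>{0..1} \<times> {0..1}. \<forall>q\<in>{0..1} \<times> {0..1}. mdist m (F p) (F q) \<le> B * mdist unit_square p q"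
    using F unfolding Lipschitz_continuous_map_pos by auto
  obtain C where "C > 0" and "G \<in> {0..1} \<times> {0..1} \<rightarrow> mspace m"
    and C: "\<forall>p\<in>{0..1} \<times> {0..1}. \<forall>q\<in>{0..1} \<times> {0..1}. mdist m (G p) (G q) \<le> C * mdist unit_square p q"
    using G unfolding Lipschitz_continuous_map_pos by auto
  have Fm: "F (s, t) \<in> mspace m" and Gm: "G (s, t) \<in> mspace m"
    if "s \<in> {0..1}" "t \<in> {0..1}" for s t
    using that \<open>F \<in> _\<close> \<open>G \<in> _\<close> by auto
  have Hm: "?H (s, t) \<in> mspace m" if "s \<in> {0..1}" "t \<in> {0..1}" for s t
    using that by (auto simp: join_path_def intro!: Fm Gm)
  define D where "D = 2 * (B + C)"
  have FD: "mdist m (F (s, t)) (F (s', t')) \<le> B * (\<bar>s - s'\<bar> + \<bar>t - t'\<bar>)"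
    if "s \<in> {0..1}" "t \<in> {0..1}" "s' \<in> {0..1}" "t' \<in> {0..1}" for s t s' t'
    using B[rule_format, of "(s, t)" "(s', t')"] that by simp
  have GD: "mdist m (G (s, t)) (G (s', t')) \<le> C * (\<bar>s - s'\<bar> + \<bar>t - t'\<bar>)"
    if "s \<in> {0..1}" "t \<in> {0..1}" "s' \<in> {0..1}" "t' \<in> {0..1}" for s t s' t'
    using C[rule_format, of "(s, t)" "(s', t')"] that by simp
  have le: "mdist m (?H (s, t)) (?H (s', t')) \<le> D * (\<bar>s - s'\<bar> + \<bar>t - t'\<bar>)"
    if I: "s \<in> {0..1}" "t \<in> {0..1}" "s' \<in> {0..1}" "t' \<in> {0..1}" and "s \<le> s'" for s t s' t'
  proof -
    have nn: "0 \<le> B * \<bar>s - s'\<bar>" "0 \<le> C * \<bar>s - s'\<bar>" "0 \<le> B * \<bar>t - t'\<bar>" "0 \<le> C * \<bar>t - t'\<bar>"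
      using \<open>B > 0\<close> \<open>C > 0\<close> by simp_all
    consider "s' \<le> 1/2" | "s \<le> 1/2" "1/2 < s'" | "1/2 < s"
      by linarith
    then show ?thesis
    proof cases
      case 1
      have "mdist m (F (2 * s, t)) (F (2 * s', t')) \<le> B * (\<bar>2 * s - 2 * s'\<bar> + \<bar>t - t'\<bar>)"
        by (rule FD) (use 1 I \<open>s \<le> s'\<close> in auto)
      moreover have "\<bar>2 * s - 2 * s'\<bar> = 2 * \<bar>s - s'\<bar>"
        using \<open>s \<le> s'\<close> by simp
      ultimately show ?thesis
        using 1 \<open>s \<le> s'\<close> nn by (simp add: join_path_def D_def algebra_simps)
    next
      case 2
      have "mdist m (F (2 * s, t)) (G (2 * s' - 1, t'))
              \<le> mdist m (F (2 * s, t)) (F (1, t)) + mdist m (F (1, t)) (G (2 * s' - 1, t'))"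
        by (rule mdist_triangle) (use 2 I in \<open>auto intro!: Fm Gm\<close>)
      also have "mdist m (F (2 * s, t)) (F (1, t)) \<le> B * (\<bar>2 * s - 1\<bar> + \<bar>t - t\<bar>)"
        by (rule FD) (use 2 I in auto)
      also have "mdist m (F (1, t)) (G (2 * s' - 1, t')) \<le> C * (\<bar>0 - (2 * s' - 1)\<bar> + \<bar>t - t'\<bar>)"
        unfolding match[OF I(2)] by (rule GD) (use 2 I in auto)
      also have "B * (\<bar>2 * s - 1\<bar> + \<bar>t - t\<bar>) \<le> B * (2 * \<bar>s - s'\<bar>)"
        using 2 \<open>B > 0\<close> by (intro mult_left_mono) auto
      also have "C * (\<bar>0 - (2 * s' - 1)\<bar> + \<bar>t - t'\<bar>) \<le> C * (2 * \<bar>s - s'\<bar> + \<bar>t - t'\<bar>)"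
        using 2 \<open>C > 0\<close> by (intro mult_left_mono) auto
      finally show ?thesis
        using 2 nn by (simp add: join_path_def D_def algebra_simps)
    next
      case 3
      have "mdist m (G (2 * s - 1, t)) (G (2 * s' - 1, t')) \<le> C * (\<bar>(2 * s - 1) - (2 * s' - 1)\<bar> + \<bar>t - t'\<bar>)"
        by (rule GD) (use 3 I \<open>s \<le> s'\<close> in auto)
      moreover have "\<bar>(2 * s - 1) - (2 * s' - 1)\<bar> = 2 * \<bar>s - s'\<bar>"
        using \<open>s \<le> s'\<close> by simp
      ultimately show ?thesis
        using 3 \<open>s \<le> s'\<close> nn by (simp add: join_path_def D_def algebra_simps)
    qed
  qed
  have "mdist m (?H (s, t)) (?H (s', t')) \<le> D * (\<bar>s - s'\<bar> + \<bar>t - t'\<bar>)"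
    if "s \<in> {0..1}" "t \<in> {0..1}" "s' \<in> {0..1}" "t' \<in> {0..1}" for s t s' t'
    using le[of s t s' t'] le[of s' t' s t] that
    by (cases "s \<le> s'") (auto simp: mdist_commute abs_minus_commute)
  then show ?thesis
    by (intro Lipschitz_squareI[of ?H m D] Hm)
qed

lemma Lipschitz_square_fst: "Lipschitz_continuous_map unit_square unit_interval fst"
  unfolding Lipschitz_continuous_map_def by (auto intro!: exI[of _ 1])

lemma Lipschitz_square_swap:
  "Lipschitz_continuous_map unit_square unit_square (\<lambda>(s, t). (t, s))"
  unfolding Lipschitz_continuous_map_def by (auto intro!: exI[of _ 1])

lemma Lipschitz_square_flip:
  "Lipschitz_continuous_map unit_square unit_square (\<lambda>(s, t). (s, 1 - t))"
  unfolding Lipschitz_continuous_map_def by (auto intro!: exI[of _ 1])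

lemma Lipschitz_square_bottom: "Lipschitz_continuous_map unit_interval unit_square (\<lambda>s. (s, 0))"
  unfolding Lipschitz_continuous_map_def by (auto intro!: exI[of _ 1])

text \<open>
  A path is a map of the square that is constant in the second variable. This makes the
  concatenation of paths a special case of gluing squares.
\<close>
lemma lip_path_square_fst:
  assumes "lip_path m \<gamma>"
  shows "Lipschitz_continuous_map unit_square m (\<lambda>(s, t). \<gamma> s)"
  using Lipschitz_continuous_map_compose[OF Lipschitz_square_fst assms[unfolded lip_path_def]]
  by (simp add: o_def case_prod_unfold)

lemma lip_path_join:
  assumes "lip_path m \<alpha>" "lip_path m \<beta>" "\<alpha> 1 = \<beta> 0"
  shows "lip_path m (join_path \<alpha> \<beta>)"
proof -
  have "Lipschitz_continuous_map unit_square m (\<lambda>(s, t). join_path \<alpha> \<beta> s)"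
    using Lipschitz_square_join[OF lip_path_square_fst lip_path_square_fst, OF assms(1,2)] assms(3)
    by simp
  from Lipschitz_continuous_map_compose[OF Lipschitz_square_bottom this] show ?thesis
    by (simp add: lip_path_def o_def)
qed

lemma lip_path_compose:
  assumes "lip_path m \<gamma>" "lip_path unit_interval \<phi>"
  shows "lip_path m (\<gamma> \<circ> \<phi>)"
  using assms Lipschitz_continuous_map_compose[of unit_interval unit_interval \<phi> m \<gamma>]
  by (simp add: lip_path_def)

lemma lip_path_cong:
  assumes "lip_path m \<gamma>" "\<And>s. s \<in> {0..1} \<Longrightarrow> \<gamma> s = \<gamma>' s"
  shows "lip_path m \<gamma>'"
  using assms Lipschitz_continuous_map_eq[of unit_interval m \<gamma> \<gamma>'] by (simp add: lip_path_def)

lemma lip_path_linepath: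
  assumes "a \<in> {0..1}" "b \<in> {0..1}"
  shows "lip_path unit_interval (linepath a b)"
proof -
  have "\<bar>linepath a b s - linepath a b t\<bar> = \<bar>b - a\<bar> * \<bar>s - t\<bar>" for s t
    unfolding abs_mult[symmetric] by (simp add: linepath_def algebra_simps)
  moreover have "linepath a b s \<in> {0..1}" if "s \<in> {0..1}" for s
    using linepath_in_path[OF that] closed_segment_subset[OF assms] by fastforce
  ultimately show ?thesis
    unfolding lip_path_def Lipschitz_continuous_map_def by (auto intro!: exI[of _ "\<bar>b - a\<bar>"])
qed

lemma lip_path_id: "lip_path unit_interval (\<lambda>s. s)"
  by (simp add: lip_path_def Lipschitz_continuous_map_id)

lemma lip_path_rev:
  assumes "lip_path m \<gamma>"
  shows "lip_path m (rev_path \<gamma>)"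
  using lip_path_compose[OF assms lip_path_linepath[of 1 0]]
  by (simp add: rev_path_def o_def linepath_def)

lemma join_path_0 [simp]: "join_path \<alpha> \<beta> 0 = \<alpha> 0"
  and join_path_1 [simp]: "join_path \<alpha> \<beta> 1 = \<beta> 1"
  and rev_path_0 [simp]: "rev_path \<alpha> 0 = \<alpha> 1"
  and rev_path_1 [simp]: "rev_path \<alpha> 1 = \<alpha> 0"
  by (simp_all add: join_path_def rev_path_def)

lemma join_path_first_half: "s \<in> {0..1} \<Longrightarrow> join_path \<alpha> \<beta> (s / 2) = \<alpha> s"
  by (simp add: join_path_def)

lemma join_path_second_half:
  assumes "s \<in> {0..1}" "\<alpha> 1 = \<beta> 0"
  shows "join_path \<alpha> \<beta> ((1 + s) / 2) = \<beta> s"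
proof -
  have eq: "2 * ((1 + s) / 2) = 1 + s"
    by simp
  show ?thesis
    unfolding join_path_def eq using assms by (cases "s = 0") auto
qed

text \<open>
  Paths cut out of a common path \<open>\<delta>\<close> are concatenated and reversed on the level of parameters, so the
  result again factors through \<open>\<delta>\<close>.
\<close>
lemma join_rev_compose:
  "join_path (rev_path (\<delta> \<circ> \<phi>)) (\<delta> \<circ> \<psi>) = \<delta> \<circ> join_path (rev_path \<phi>) \<psi>"
  by (auto simp: join_path_def rev_path_def)

section \<open>Homotopy\<close>

lemma lip_homotopicI:
  assumes "lip_path m \<gamma>" "lip_path m \<gamma>'" "Lipschitz_continuous_map unit_square m H"
    and "\<And>s. s \<in> {0..1} \<Longrightarrow> H (s, 0) = \<gamma> s" "\<And>s. s \<in> {0..1} \<Longrightarrow> H (s, 1) = \<gamma>' s"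
    and "\<And>t. t \<in> {0..1} \<Longrightarrow> H (0, t) = \<gamma> 0" "\<And>t. t \<in> {0..1} \<Longrightarrow> H (1, t) = \<gamma> 1"
  shows "lip_homotopic m \<gamma> \<gamma>'"
proof -
  have "\<gamma> 0 = \<gamma>' 0"
    using assms(5)[of 0] assms(6)[of 1] by simp
  moreover have "\<gamma> 1 = \<gamma>' 1"
    using assms(5)[of 1] assms(7)[of 1] by simp
  ultimately show ?thesis
    using assms unfolding lip_homotopic_def by blast
qed

lemma lip_path_constant:
  assumes "lip_path m \<gamma>"
  obtains B where "B > 0"
    "\<And>s t. s \<in> {0..1} \<Longrightarrow> t \<in> {0..1} \<Longrightarrow> mdist m (\<gamma> s) (\<gamma> t) \<le> B * \<bar>s - t\<bar>"
proof -
  obtain B where "B > 0" "\<forall>s\<in>{0..1}. \<forall>t\<in>{0..1}. mdist m (\<gamma> s) (\<gamma> t) \<le> B * \<bar>s - t\<bar>"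
    using assms unfolding lip_path_def Lipschitz_continuous_map_pos by auto
  then show ?thesis
    using that by blast
qed

lemma lip_path_in_mspace: "lip_path m \<gamma> \<Longrightarrow> s \<in> {0..1} \<Longrightarrow> \<gamma> s \<in> mspace m"
  unfolding lip_path_def Lipschitz_continuous_map_def by auto

text \<open>
  The unit interval is convex, so the parameters can be moved along straight lines. This one
  homotopy contains the independence of parametrization, the neutrality of constant paths and
  the cancellation of a path against its inverse.
\<close>
lemma lip_homotopic_reparam:
  assumes \<delta>: "lip_path m \<delta>"
    and \<phi>: "lip_path unit_interval \<phi>" and \<psi>: "lip_path unit_interval \<psi>"
    and "\<phi> 0 = \<psi> 0" "\<phi> 1 = \<psi> 1"
    and \<alpha>: "\<And>s. s \<in> {0..1} \<Longrightarrow> \<alpha> s = \<delta> (\<phi> s)"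
    and \<beta>: "\<And>s. s \<in> {0..1} \<Longrightarrow> \<beta> s = \<delta> (\<psi> s)"
  shows "lip_homotopic m \<alpha> \<beta>"
proof -
  obtain B where "B > 0" and B: "\<And>s t. s \<in> {0..1} \<Longrightarrow> t \<in> {0..1} \<Longrightarrow> \<bar>\<phi> s - \<phi> t\<bar> \<le> B * \<bar>s - t\<bar>"
    using lip_path_constant[OF \<phi>] by (metis mdist_unit_interval)
  have \<phi>I: "\<phi> s \<in> {0..1}" if "s \<in> {0..1}" for s
    using lip_path_in_mspace[OF \<phi> that] by simp
  obtain C where "C > 0" and C: "\<And>s t. s \<in> {0..1} \<Longrightarrow> t \<in> {0..1} \<Longrightarrow> \<bar>\<psi> s - \<psi> t\<bar> \<le> C * \<bar>s - t\<bar>"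
    using lip_path_constant[OF \<psi>] by (metis mdist_unit_interval)
  have \<psi>I: "\<psi> s \<in> {0..1}" if "s \<in> {0..1}" for s
    using lip_path_in_mspace[OF \<psi> that] by simp
  let ?h = "\<lambda>(s, t). linepath (\<phi> s) (\<psi> s) t"
  have "\<bar>?h (s, t) - ?h (s', t')\<bar> \<le> (B + C + 1) * (\<bar>s - s'\<bar> + \<bar>t - t'\<bar>)"
    if I: "s \<in> {0..1}" "t \<in> {0..1}" "s' \<in> {0..1}" "t' \<in> {0..1}" for s t s' t'
  proof -
    have "?h (s, t) - ?h (s', t')
        = (1 - t) * (\<phi> s - \<phi> s') + t * (\<psi> s - \<psi> s') + (t - t') * (\<psi> s' - \<phi> s')"
      by (simp add: linepath_def algebra_simps)
    also have "\<bar>\<dots>\<bar> \<le> (1 - t) * \<bar>\<phi> s - \<phi> s'\<bar> + t * \<bar>\<psi> s - \<psi> s'\<bar> + \<bar>t - t'\<bar> * \<bar>\<psi> s' - \<phi> s'\<bar>"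
      using I by (intro abs_triangle_ineq[THEN order_trans] add_mono) (auto simp: abs_mult)
    also have "(1 - t) * \<bar>\<phi> s - \<phi> s'\<bar> \<le> 1 * (B * \<bar>s - s'\<bar>)"
      using I B by (intro mult_mono) auto
    also have "t * \<bar>\<psi> s - \<psi> s'\<bar> \<le> 1 * (C * \<bar>s - s'\<bar>)"
      using I C by (intro mult_mono) auto
    also have "\<bar>t - t'\<bar> * \<bar>\<psi> s' - \<phi> s'\<bar> \<le> \<bar>t - t'\<bar> * 1"
      using \<phi>I[OF I(3)] \<psi>I[OF I(3)] by (intro mult_left_mono) auto
    finally have "\<bar>?h (s, t) - ?h (s', t')\<bar> \<le> B * \<bar>s - s'\<bar> + C * \<bar>s - s'\<bar> + \<bar>t - t'\<bar>"
      by simp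
    moreover have "0 \<le> B * \<bar>t - t'\<bar>" "0 \<le> C * \<bar>t - t'\<bar>" "0 \<le> \<bar>s - s'\<bar>"
      using \<open>B > 0\<close> \<open>C > 0\<close> by simp_all
    ultimately show ?thesis
      unfolding distrib_left distrib_right mult_1 by linarith
  qed
  moreover have "?h (s, t) \<in> {0..1}" if "s \<in> {0..1}" "t \<in> {0..1}" for s t
    using lip_path_in_mspace[OF lip_path_linepath[OF \<phi>I \<psi>I, of s s]] that by simp
  ultimately have "Lipschitz_continuous_map unit_square unit_interval ?h"
    by (intro Lipschitz_squareI[where D = "B + C + 1"]) (simp_all only: mspace_unit_interval mdist_unit_interval)
  then have "Lipschitz_continuous_map unit_square m (\<delta> \<circ> ?h)"
    using \<delta> Lipschitz_continuous_map_compose unfolding lip_path_def by blast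
  moreover have "lip_path m \<alpha>"
    by (rule lip_path_cong[OF lip_path_compose[OF \<delta> \<phi>]]) (simp add: \<alpha>)
  moreover have "lip_path m \<beta>"
    by (rule lip_path_cong[OF lip_path_compose[OF \<delta> \<psi>]]) (simp add: \<beta>)
  ultimately show ?thesis
  proof (intro lip_homotopicI[of m \<alpha> \<beta> "\<delta> \<circ> ?h"])
    have const: "linepath a a t = a" for a t :: real
      by (simp add: linepath_def algebra_simps)
    show "(\<delta> \<circ> ?h) (s, 0) = \<alpha> s" "(\<delta> \<circ> ?h) (s, 1) = \<beta> s" if "s \<in> {0..1}" for s
      using \<alpha>[OF that] \<beta>[OF that] by (simp_all add: linepath_0' linepath_1')
    show "(\<delta> \<circ> ?h) (0, t) = \<alpha> 0" "(\<delta> \<circ> ?h) (1, t) = \<alpha> 1" for t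
      using \<alpha>[of 0] \<alpha>[of 1] \<open>\<phi> 0 = \<psi> 0\<close> \<open>\<phi> 1 = \<psi> 1\<close> by (simp_all add: const)
  qed
qed

lemma lip_homotopic_refl: assumes g: "lip_path m \<gamma>" shows "lip_homotopic m \<gamma> \<gamma>"
  by (rule lip_homotopic_reparam[OF g lip_path_id lip_path_id]) (rule refl)+

lemma lip_homotopic_sym:
  assumes "lip_homotopic m \<gamma> \<gamma>'"
  shows "lip_homotopic m \<gamma>' \<gamma>"
proof -
  obtain H where H: "lip_path m \<gamma>" "lip_path m \<gamma>'" "\<gamma> 0 = \<gamma>' 0" "\<gamma> 1 = \<gamma>' 1"
    "Lipschitz_continuous_map unit_square m H"
    "\<And>s. s \<in> {0..1} \<Longrightarrow> H (s, 0) = \<gamma> s" "\<And>s. s \<in> {0..1} \<Longrightarrow> H (s, 1) = \<gamma>' s"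
    "\<And>t. t \<in> {0..1} \<Longrightarrow> H (0, t) = \<gamma> 0" "\<And>t. t \<in> {0..1} \<Longrightarrow> H (1, t) = \<gamma> 1"
    using assms unfolding lip_homotopic_def by blast
  have "Lipschitz_continuous_map unit_square m (H \<circ> (\<lambda>(s, t). (s, 1 - t)))"
    by (rule Lipschitz_continuous_map_compose[OF Lipschitz_square_flip H(5)])
  then show ?thesis
    by (rule lip_homotopicI[rotated 2]) (use H in auto)
qed

lemma lip_homotopic_trans [trans]:
  assumes "lip_homotopic m \<alpha> \<beta>" "lip_homotopic m \<beta> \<gamma>"
  shows "lip_homotopic m \<alpha> \<gamma>"
proof -
  obtain F where F: "lip_path m \<alpha>" "\<alpha> 0 = \<beta> 0" "\<alpha> 1 = \<beta> 1"
    "Lipschitz_continuous_map unit_square m F"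
    "\<And>s. s \<in> {0..1} \<Longrightarrow> F (s, 0) = \<alpha> s" "\<And>s. s \<in> {0..1} \<Longrightarrow> F (s, 1) = \<beta> s"
    "\<And>t. t \<in> {0..1} \<Longrightarrow> F (0, t) = \<alpha> 0" "\<And>t. t \<in> {0..1} \<Longrightarrow> F (1, t) = \<alpha> 1"
    using assms(1) unfolding lip_homotopic_def by blast
  obtain G where G: "lip_path m \<gamma>"
    "Lipschitz_continuous_map unit_square m G"
    "\<And>s. s \<in> {0..1} \<Longrightarrow> G (s, 0) = \<beta> s" "\<And>s. s \<in> {0..1} \<Longrightarrow> G (s, 1) = \<gamma> s"
    "\<And>t. t \<in> {0..1} \<Longrightarrow> G (0, t) = \<beta> 0" "\<And>t. t \<in> {0..1} \<Longrightarrow> G (1, t) = \<beta> 1"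
    using assms(2) unfolding lip_homotopic_def by blast
  \<comment> \<open>Stacking in the second variable is gluing in the first one, conjugated by the swap.\<close>
  let ?swap = "\<lambda>(s, t). (t :: real, s :: real)"
  let ?H = "\<lambda>(s, t). join_path (\<lambda>s. (F \<circ> ?swap) (s, t)) (\<lambda>s. (G \<circ> ?swap) (s, t)) s"
  have "Lipschitz_continuous_map unit_square m ?H"
    using F G by (intro Lipschitz_square_join Lipschitz_continuous_map_compose[OF Lipschitz_square_swap]) auto
  then have "Lipschitz_continuous_map unit_square m (?H \<circ> ?swap)"
    by (rule Lipschitz_continuous_map_compose[OF Lipschitz_square_swap])
  then show ?thesis
    by (rule lip_homotopicI[rotated 2]) (use F G in \<open>auto simp: join_path_def\<close>)
qed

lemma lip_homotopic_join_right:
  assumes "lip_path m \<alpha>" "\<alpha> 1 = \<beta> 0" "lip_homotopic m \<beta> \<beta>'"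
  shows "lip_homotopic m (join_path \<alpha> \<beta>) (join_path \<alpha> \<beta>')"
proof -
  obtain G where G: "lip_path m \<beta>" "lip_path m \<beta>'" "\<beta> 0 = \<beta>' 0" "\<beta> 1 = \<beta>' 1"
    "Lipschitz_continuous_map unit_square m G"
    "\<And>s. s \<in> {0..1} \<Longrightarrow> G (s, 0) = \<beta> s" "\<And>s. s \<in> {0..1} \<Longrightarrow> G (s, 1) = \<beta>' s"
    "\<And>t. t \<in> {0..1} \<Longrightarrow> G (0, t) = \<beta> 0" "\<And>t. t \<in> {0..1} \<Longrightarrow> G (1, t) = \<beta> 1"
    using assms(3) unfolding lip_homotopic_def by blast
  have "Lipschitz_continuous_map unit_square m
          (\<lambda>(s, t). join_path (\<lambda>s. (\<lambda>(s, t). \<alpha> s) (s, t)) (\<lambda>s. G (s, t)) s)"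
    by (rule Lipschitz_square_join[OF lip_path_square_fst]) (use assms G in auto)
  then show ?thesis
  proof (rule lip_homotopicI[rotated 2])
    show "lip_path m (join_path \<alpha> \<beta>)" "lip_path m (join_path \<alpha> \<beta>')"
      using assms G by (auto intro!: lip_path_join)
  qed (use assms G in \<open>auto simp: join_path_def\<close>)
qed

text \<open>
  Both sides factor through \<open>\<delta>\<close>, the inverse of \<open>\<alpha>\<close> followed by \<open>\<gamma>\<close>: its midpoint is the common
  starting point of \<open>\<alpha>\<close> and \<open>\<gamma>\<close>, so the left side has the parameter run from \<open>1/2\<close> down to \<open>0\<close> and
  then up to \<open>1\<close>, the right side straight from \<open>1/2\<close> to \<open>1\<close>.
\<close>
lemma lip_homotopic_join_join_rev:
  assumes "lip_path m \<alpha>" "lip_path m \<gamma>" "\<alpha> 0 = \<gamma> 0"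
  shows "lip_homotopic m (join_path \<alpha> (join_path (rev_path \<alpha>) \<gamma>)) \<gamma>"
proof -
  let ?\<delta> = "join_path (rev_path \<alpha>) \<gamma>"
  let ?\<phi> = "join_path (linepath (1/2) 0) (linepath 0 1) :: real \<Rightarrow> real"
  show ?thesis
  proof (rule lip_homotopic_reparam)
    show "lip_path m ?\<delta>"
      using assms by (intro lip_path_join lip_path_rev) auto
    show "lip_path unit_interval ?\<phi>"
      by (intro lip_path_join lip_path_linepath) (auto simp: linepath_def)
    show "lip_path unit_interval (linepath (1/2) 1)"
      by (intro lip_path_linepath) auto
    show "join_path \<alpha> ?\<delta> s = ?\<delta> (?\<phi> s)" if "s \<in> {0..1}" for s
      using that by (auto simp: join_path_def rev_path_def linepath_def field_simps)
    show "\<gamma> s = ?\<delta> (linepath (1/2) 1 s)" if "s \<in> {0..1}" for s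
    proof -
      have "linepath (1/2) 1 s = (1 + s) / 2"
        by (simp add: linepath_def field_simps)
      then show ?thesis
        using join_path_second_half[OF that, of "rev_path \<alpha>" \<gamma>] assms(3) by (metis rev_path_1)
    qed
  qed (auto simp: linepath_def)
qed

lemma homotopy_class_eq:
  "lip_homotopic m \<gamma> \<gamma>' \<Longrightarrow> homotopy_class m \<gamma> = homotopy_class m \<gamma>'"
  unfolding homotopy_class_def using lip_homotopic_sym lip_homotopic_trans by blast

section \<open>Length of paths\<close>

definition partition_sums :: "'a metric \<Rightarrow> (real \<Rightarrow> 'a) \<Rightarrow> real \<Rightarrow> real \<Rightarrow> real set" where
  "partition_sums m \<gamma> a b =
     {\<Sum>i<n. mdist m (\<gamma> (t i)) (\<gamma> (t (Suc i))) | n t. mono_on {..n} t \<and> t 0 = a \<and> t n = b}"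

text \<open>
  The length of the piece of \<open>\<gamma>\<close> over \<open>[a, b]\<close>. Keeping the parameters of \<open>\<gamma>\<close>, instead of rescaling
  each piece to the unit interval, makes the comparison of adjacent pieces a concatenation of
  subdivisions.
\<close>
definition variation :: "'a metric \<Rightarrow> (real \<Rightarrow> 'a) \<Rightarrow> real \<Rightarrow> real \<Rightarrow> real" where
  "variation m \<gamma> a b = Sup (partition_sums m \<gamma> a b)"

lemma path_length_eq_variation: "path_length m \<gamma> = variation m \<gamma> 0 1"
  by (simp add: path_length_def variation_def partition_sums_def)

lemma partition_sumsI:
  "mono_on {..n} t \<Longrightarrow> t 0 = a \<Longrightarrow> t n = b \<Longrightarrow>
     (\<Sum>i<n. mdist m (\<gamma> (t i)) (\<gamma> (t (Suc i)))) \<in> partition_sums m \<gamma> a b"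
  unfolding partition_sums_def by blast

lemma partition_sums_nonempty:
  assumes "a \<le> b"
  shows "partition_sums m \<gamma> a b \<noteq> {}"
proof -
  have "mono_on {..1} (\<lambda>i :: nat. if i = 0 then a else b)"
    using assms by (auto simp: mono_on_def)
  from partition_sumsI[OF this, of a b m \<gamma>] show ?thesis
    by auto
qed

lemma partition_sums_nonneg: "x \<in> partition_sums m \<gamma> a b \<Longrightarrow> 0 \<le> x"
  by (auto simp: partition_sums_def intro!: sum_nonneg)

lemma partition_in_interval:
  fixes t :: "nat \<Rightarrow> real"
  assumes "mono_on {..n} t" "i \<le> n"
  shows "t 0 \<le> t i" "t i \<le> t n"
  using assms by (auto intro!: mono_onD[OF assms(1)])

lemma partition_sums_Lipschitz_le:
  assumes B: "\<And>s t. s \<in> {0..1} \<Longrightarrow> t \<in> {0..1} \<Longrightarrow> mdist m (\<gamma> s) (\<gamma> t) \<le> B * \<bar>s - t\<bar>"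
    and "0 \<le> a" "b \<le> 1" and x: "x \<in> partition_sums m \<gamma> a b"
  shows "x \<le> B * (b - a)"
proof -
  obtain n t where x: "x = (\<Sum>i<n. mdist m (\<gamma> (t i)) (\<gamma> (t (Suc i))))"
    and t: "mono_on {..n} t" "t 0 = a" "t n = b"
    using x unfolding partition_sums_def by blast
  have "x \<le> (\<Sum>i<n. B * (t (Suc i) - t i))"
    unfolding x
  proof (rule sum_mono)
    fix i assume "i \<in> {..<n}"
    then have "t i \<in> {0..1}" "t (Suc i) \<in> {0..1}" "t i \<le> t (Suc i)"
      using partition_in_interval[OF t(1), of i] partition_in_interval[OF t(1), of "Suc i"]
        assms(2,3) t by (auto intro!: mono_onD[OF t(1)])
    then show "mdist m (\<gamma> (t i)) (\<gamma> (t (Suc i))) \<le> B * (t (Suc i) - t i)"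
      using B[of "t i" "t (Suc i)"] by simp
  qed
  also have "\<dots> = B * (b - a)"
    using t by (simp add: sum_distrib_left[symmetric] sum_lessThan_telescope)
  finally show ?thesis .
qed

lemma partition_sums_bdd_above:
  assumes "lip_path m \<gamma>" "0 \<le> a" "b \<le> 1"
  shows "bdd_above (partition_sums m \<gamma> a b)"
proof -
  obtain B where "\<And>s t. s \<in> {0..1} \<Longrightarrow> t \<in> {0..1} \<Longrightarrow> mdist m (\<gamma> s) (\<gamma> t) \<le> B * \<bar>s - t\<bar>"
    using assms(1) by (rule lip_path_constant) blast
  then show ?thesis
    using partition_sums_Lipschitz_le assms by (intro bdd_aboveI) blast
qed

lemma variation_nonneg:
  assumes "lip_path m \<gamma>" "0 \<le> a" "a \<le> b" "b \<le> 1"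
  shows "0 \<le> variation m \<gamma> a b"
proof -
  obtain x where "x \<in> partition_sums m \<gamma> a b"
    using partition_sums_nonempty[OF assms(3)] by blast
  then show ?thesis
    unfolding variation_def
    using partition_sums_nonneg cSup_upper2 partition_sums_bdd_above assms by metis
qed

lemma partition_sums_add:
  assumes x: "x \<in> partition_sums m \<gamma> a b" and y: "y \<in> partition_sums m \<gamma> b c"
  shows "x + y \<in> partition_sums m \<gamma> a c"
proof -
  obtain n t where x: "x = (\<Sum>i<n. mdist m (\<gamma> (t i)) (\<gamma> (t (Suc i))))"
    and t: "mono_on {..n} t" "t 0 = a" "t n = b"
    using x unfolding partition_sums_def by blast
  obtain k u where y: "y = (\<Sum>i<k. mdist m (\<gamma> (u i)) (\<gamma> (u (Suc i))))"
    and u: "mono_on {..k} u" "u 0 = b" "u k = c"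
    using y unfolding partition_sums_def by blast
  define v where "v = (\<lambda>i. if i \<le> n then t i else u (i - n))"
  have vu: "v (n + i) = u i" for i
    using t u by (cases i) (auto simp: v_def)
  have "mono_on {..n + k} v"
  proof (rule mono_onI)
    fix i j assume ij: "i \<in> {..n + k}" "j \<in> {..n + k}" "i \<le> j"
    consider "j \<le> n" | "i \<le> n" "n < j" | "n < i"
      by linarith
    then show "v i \<le> v j"
    proof cases
      case 1
      then show ?thesis
        using ij t by (auto simp: v_def intro!: mono_onD[OF t(1)])
    next
      case 2
      then have "j - n \<le> k"
        using ij by simp
      then show ?thesis
        using 2 partition_in_interval(2)[OF t(1), of i] partition_in_interval(1)[OF u(1), of "j - n"]
          t u by (simp add: v_def)
    next
      case 3
      then show ?thesis
        using ij by (auto simp: v_def intro!: mono_onD[OF u(1)])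
    qed
  qed
  moreover have "v 0 = a" "v (n + k) = c"
    using t u vu by (auto simp: v_def)
  ultimately have "(\<Sum>i<n + k. mdist m (\<gamma> (v i)) (\<gamma> (v (Suc i)))) \<in> partition_sums m \<gamma> a c"
    by (rule partition_sumsI)
  moreover have "(\<Sum>i<n + k. mdist m (\<gamma> (v i)) (\<gamma> (v (Suc i)))) = x + y"
  proof -
    have split: "(\<Sum>i<n + k. f i) = (\<Sum>i<n. f i) + (\<Sum>i<k. f (n + i))" for f :: "nat \<Rightarrow> real"
      by (induction k) (simp_all add: algebra_simps)
    have "v (Suc (n + i)) = u (Suc i)" for i
      using vu[of "Suc i"] by simp
    then show ?thesis
      unfolding split x y by (simp add: vu) (simp add: v_def)
  qed
  ultimately show ?thesis
    by simp
qed

text \<open>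
  Subdivisions of \<open>[a, b]\<close> and \<open>[b, c]\<close> concatenate to subdivisions of \<open>[a, c]\<close> (exactly those
  that contain \<open>b\<close>). This is the direction of additivity that bounds the length of a lift from above.
\<close>
lemma variation_superadditive:
  assumes \<gamma>: "lip_path m \<gamma>" and "0 \<le> a" "a \<le> b" "b \<le> c" "c \<le> 1"
  shows "variation m \<gamma> a b + variation m \<gamma> b c \<le> variation m \<gamma> a c"
proof -
  have sum_le: "x + y \<le> variation m \<gamma> a c"
    if "x \<in> partition_sums m \<gamma> a b" "y \<in> partition_sums m \<gamma> b c" for x y
    unfolding variation_def
    using assms that by (intro cSup_upper partition_sums_add partition_sums_bdd_above) auto
  have "variation m \<gamma> a b \<le> variation m \<gamma> a c - y" if "y \<in> partition_sums m \<gamma> b c" for y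
    unfolding variation_def[of m \<gamma> a b]
    using assms sum_le[OF _ that]
    by (intro cSup_least partition_sums_nonempty) (auto simp: le_diff_eq)
  then have "variation m \<gamma> b c \<le> variation m \<gamma> a c - variation m \<gamma> a b"
    unfolding variation_def[of m \<gamma> b c]
    using assms by (intro cSup_least partition_sums_nonempty) (auto simp: algebra_simps)
  then show ?thesis
    by simp
qed

lemma sum_variation_le:
  assumes \<gamma>: "lip_path m \<gamma>" and t: "mono_on {..n} t" "0 \<le> t 0" "t n \<le> 1"
  shows "(\<Sum>i<n. variation m \<gamma> (t i) (t (Suc i))) \<le> variation m \<gamma> (t 0) (t n)"
proof -
  have "(\<Sum>i<k. variation m \<gamma> (t i) (t (Suc i))) \<le> variation m \<gamma> (t 0) (t k)" if "k \<le> n" for k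
    using that
  proof (induction k)
    case 0
    then show ?case
      using partition_in_interval[OF t(1), of 0] t by (auto intro!: variation_nonneg[OF \<gamma>])
  next
    case (Suc k)
    have "t 0 \<le> t k" "t k \<le> t (Suc k)" "t (Suc k) \<le> t n"
      using Suc.prems by (auto intro!: mono_onD[OF t(1)])
    then show ?case
      using variation_superadditive[OF \<gamma>, of "t 0" "t k" "t (Suc k)"] Suc t by simp
  qed
  then show ?thesis
    by blast
qed

text \<open>
  The monotone map \<open>linepath a b\<close> carries subdivisions of \<open>[0, 1]\<close> to subdivisions of \<open>[a, b]\<close>
  without changing their sums.
\<close>
lemma path_length_restriction_le_variation:
  assumes \<gamma>: "lip_path m \<gamma>" and "0 \<le> a" "a \<le> b" "b \<le> 1"
  shows "path_length m (\<gamma> \<circ> linepath a b) \<le> variation m \<gamma> a b"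
proof -
  have "x \<in> partition_sums m \<gamma> a b" if x: "x \<in> partition_sums m (\<gamma> \<circ> linepath a b) 0 1" for x
  proof -
    obtain n t where x: "x = (\<Sum>i<n. mdist m ((\<gamma> \<circ> linepath a b) (t i)) ((\<gamma> \<circ> linepath a b) (t (Suc i))))"
      and t: "mono_on {..n} t" "t 0 = 0" "t n = 1"
      using x unfolding partition_sums_def by blast
    have lin: "linepath a b s \<le> linepath a b s'" if "s \<le> s'" for s s'
    proof -
      have "linepath a b s = a + (b - a) * s" for s
        by (simp add: linepath_def algebra_simps)
      then show ?thesis
        using that assms by (simp add: mult_left_mono)
    qed
    have "mono_on {..n} (linepath a b \<circ> t)"
      using t(1) lin by (auto simp: mono_on_def)
    from partition_sumsI[OF this, of a b m \<gamma>] show ?thesis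
      using t by (simp add: x linepath_0' linepath_1')
  qed
  then show ?thesis
    unfolding path_length_eq_variation variation_def
    using assms by (intro cSup_subset_mono partition_sums_nonempty partition_sums_bdd_above) auto
qed

text \<open>
  The bound on distances is summed over a subdivision by superadditivity. The Lipschitz constant
  is inherited because the variation of \<open>\<beta>\<close> over an interval is at most its Lipschitz constant
  times the length of the interval.
\<close>
lemma path_dominated_by_variation:
  assumes \<beta>: "lip_path m \<beta>"
    and \<Gamma>: "\<And>s. s \<in> {0..1} \<Longrightarrow> \<Gamma> s \<in> mspace k"
    and le: "\<And>a b. 0 \<le> a \<Longrightarrow> a \<le> b \<Longrightarrow> b \<le> 1 \<Longrightarrow> mdist k (\<Gamma> a) (\<Gamma> b) \<le> variation m \<beta> a b"
  shows "lip_path k \<Gamma>" "path_length k \<Gamma> \<le> path_length m \<beta>"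
proof -
  obtain B where B: "\<And>s t. s \<in> {0..1} \<Longrightarrow> t \<in> {0..1} \<Longrightarrow> mdist m (\<beta> s) (\<beta> t) \<le> B * \<bar>s - t\<bar>"
    using \<beta> by (rule lip_path_constant) blast
  have ordered: "mdist k (\<Gamma> a) (\<Gamma> b) \<le> B * \<bar>a - b\<bar>" if "0 \<le> a" "a \<le> b" "b \<le> 1" for a b
  proof -
    have "variation m \<beta> a b \<le> B * (b - a)"
      unfolding variation_def
      using that by (intro cSup_least partition_sums_nonempty partition_sums_Lipschitz_le[OF B])
    then show ?thesis
      using le[OF that] that by simp
  qed
  have "mdist k (\<Gamma> a) (\<Gamma> b) \<le> B * \<bar>a - b\<bar>" if "a \<in> {0..1}" "b \<in> {0..1}" for a b
    using ordered[of a b] ordered[of b a] that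
    by (cases "a \<le> b") (auto simp: mdist_commute abs_minus_commute)
  then show "lip_path k \<Gamma>"
    unfolding lip_path_def Lipschitz_continuous_map_def using \<Gamma> by (auto intro!: exI[of _ B])
  have "x \<le> path_length m \<beta>" if x: "x \<in> partition_sums k \<Gamma> 0 1" for x
  proof -
    obtain n t where x: "x = (\<Sum>i<n. mdist k (\<Gamma> (t i)) (\<Gamma> (t (Suc i))))"
      and t: "mono_on {..n} t" "t 0 = 0" "t n = 1"
      using x unfolding partition_sums_def by blast
    have "x \<le> (\<Sum>i<n. variation m \<beta> (t i) (t (Suc i)))"
      unfolding x
    proof (intro sum_mono le)
      fix i assume "i \<in> {..<n}"
      then show "0 \<le> t i" "t i \<le> t (Suc i)" "t (Suc i) \<le> 1"
        using partition_in_interval[OF t(1), of i] partition_in_interval[OF t(1), of "Suc i"] t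
        by (auto intro!: mono_onD[OF t(1)])
    qed
    also have "\<dots> \<le> path_length m \<beta>"
      using sum_variation_le[OF \<beta> t(1)] t by (simp add: path_length_eq_variation)
    finally show ?thesis .
  qed
  then show "path_length k \<Gamma> \<le> path_length m \<beta>"
    unfolding path_length_eq_variation[of k] variation_def
    by (intro cSup_least partition_sums_nonempty) auto
qed

section \<open>The path space\<close>

lemma path_length_nonneg: "lip_path m \<gamma> \<Longrightarrow> 0 \<le> path_length m \<gamma>"
  by (simp add: path_length_eq_variation variation_nonneg)

lemma homotopy_class_in_path_space:
  "lip_path m \<gamma> \<Longrightarrow> \<gamma> 0 = p \<Longrightarrow> homotopy_class m \<gamma> \<in> path_space m p"
  unfolding path_space_def by blast

lemma path_space_dist_le:
  assumes "lip_path m \<gamma>\<^sub>1" "lip_path m \<gamma>\<^sub>2" "\<gamma>\<^sub>1 0 = p" "\<gamma>\<^sub>2 0 = p"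
    and \<beta>: "lip_homotopic m \<beta> (join_path (rev_path \<gamma>\<^sub>1) \<gamma>\<^sub>2)"
  shows "path_space_dist m p (homotopy_class m \<gamma>\<^sub>1) (homotopy_class m \<gamma>\<^sub>2) \<le> path_length m \<beta>"
proof -
  let ?L = "{path_length m \<beta> | \<beta> \<alpha>\<^sub>1 \<alpha>\<^sub>2. \<alpha>\<^sub>1 \<in> homotopy_class m \<gamma>\<^sub>1 \<and> \<alpha>\<^sub>2 \<in> homotopy_class m \<gamma>\<^sub>2 \<and>
              lip_homotopic m \<beta> (join_path (rev_path \<alpha>\<^sub>1) \<alpha>\<^sub>2)}"
  have "Inf ?L \<le> path_length m \<beta>"
  proof (rule cInf_lower)
    have "\<gamma>\<^sub>1 \<in> homotopy_class m \<gamma>\<^sub>1" "\<gamma>\<^sub>2 \<in> homotopy_class m \<gamma>\<^sub>2"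
      using assms by (auto simp: homotopy_class_def intro: lip_homotopic_refl)
    then show "path_length m \<beta> \<in> ?L"
      using \<beta> by blast
    show "bdd_below ?L"
      by (rule bdd_belowI[of _ 0]) (auto simp: lip_homotopic_def path_length_nonneg)
  qed
  then show ?thesis
    unfolding path_space_dist_def using assms by (simp add: homotopy_class_in_path_space)
qed

text \<open>
  The infimum defining the distance is over a nonempty set, since \<open>\<gamma>\<^sub>1\<close> and \<open>\<gamma>\<^sub>2\<close> have the same
  starting point and can be concatenated; so every larger number exceeds the length of a competitor.
\<close>
lemma path_space_dist_approx:
  assumes "c\<^sub>1 \<in> path_space m p" "c\<^sub>2 \<in> path_space m p" "path_space_dist m p c\<^sub>1 c\<^sub>2 < r"
  obtains \<beta> \<gamma>\<^sub>1 \<gamma>\<^sub>2 where "lip_path m \<gamma>\<^sub>1" "\<gamma>\<^sub>1 0 = p" "c\<^sub>1 = homotopy_class m \<gamma>\<^sub>1"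
    "lip_path m \<gamma>\<^sub>2" "\<gamma>\<^sub>2 0 = p" "c\<^sub>2 = homotopy_class m \<gamma>\<^sub>2"
    "lip_homotopic m \<beta> (join_path (rev_path \<gamma>\<^sub>1) \<gamma>\<^sub>2)" "path_length m \<beta> < r"
proof -
  have rep: "lip_path m \<gamma>" "\<gamma> 0 = p" "c = homotopy_class m \<gamma>"
    if c: "c \<in> path_space m p" "\<gamma> \<in> c" for c \<gamma>
  proof -
    obtain \<gamma>' where "\<gamma>' 0 = p" "c = homotopy_class m \<gamma>'" "lip_homotopic m \<gamma>' \<gamma>"
      using c unfolding path_space_def homotopy_class_def by blast
    then show "lip_path m \<gamma>" "\<gamma> 0 = p"
      unfolding lip_homotopic_def by metis+
    show "c = homotopy_class m \<gamma>"
      unfolding \<open>c = _\<close> by (rule homotopy_class_eq) fact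
  qed
  have ex: "\<exists>\<gamma>. \<gamma> \<in> c" if "c \<in> path_space m p" for c
    using that lip_homotopic_refl unfolding path_space_def homotopy_class_def by blast
  let ?L = "{path_length m \<beta> | \<beta> \<gamma>\<^sub>1 \<gamma>\<^sub>2. \<gamma>\<^sub>1 \<in> c\<^sub>1 \<and> \<gamma>\<^sub>2 \<in> c\<^sub>2 \<and>
              lip_homotopic m \<beta> (join_path (rev_path \<gamma>\<^sub>1) \<gamma>\<^sub>2)}"
  obtain \<gamma>\<^sub>1 \<gamma>\<^sub>2 where g: "\<gamma>\<^sub>1 \<in> c\<^sub>1" "\<gamma>\<^sub>2 \<in> c\<^sub>2"
    using ex[OF assms(1)] ex[OF assms(2)] by blast
  then have "lip_path m (join_path (rev_path \<gamma>\<^sub>1) \<gamma>\<^sub>2)"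
    using rep[OF assms(1)] rep[OF assms(2)] by (intro lip_path_join lip_path_rev) auto
  then have "?L \<noteq> {}"
    using g lip_homotopic_refl by blast
  moreover have "Inf ?L < r"
    using assms by (simp add: path_space_dist_def)
  ultimately have "\<exists>x\<in>?L. x < r"
    by (rule cInf_lessD)
  then obtain \<beta> \<alpha>\<^sub>1 \<alpha>\<^sub>2 where "\<alpha>\<^sub>1 \<in> c\<^sub>1" "\<alpha>\<^sub>2 \<in> c\<^sub>2"
    "lip_homotopic m \<beta> (join_path (rev_path \<alpha>\<^sub>1) \<alpha>\<^sub>2)" "path_length m \<beta> < r"
    by blast
  then show ?thesis
    using that rep[OF assms(1)] rep[OF assms(2)] by metis
qed

text \<open>
  The lift: \<open>\<phi> s\<close> restricts \<open>\<delta>\<close> to \<open>[0, (1 + s) / 2]\<close>, because \<open>\<beta>\<close> occupies the second half of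
  the parameter interval of \<open>\<delta>\<close>.
\<close>
lemma lift_path:
  assumes \<alpha>: "lip_path m \<alpha>" "\<alpha> 0 = p" and \<beta>: "lip_path m \<beta>" "\<alpha> 1 = \<beta> 0"
    and P: "Metric_space (path_space m p) (path_space_dist m p)"
  obtains \<Gamma> where "lip_path (metric (path_space m p, path_space_dist m p)) \<Gamma>"
    "\<Gamma> 0 = homotopy_class m \<alpha>" "\<Gamma> 1 = homotopy_class m (join_path \<alpha> \<beta>)"
    "path_length (metric (path_space m p, path_space_dist m p)) \<Gamma> \<le> path_length m \<beta>"
proof -
  let ?P = "metric (path_space m p, path_space_dist m p)"
  have mdistP: "mdist ?P = path_space_dist m p" and mspaceP: "mspace ?P = path_space m p"
    using Metric_space.mdist_metric[OF P] Metric_space.mspace_metric[OF P] by auto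
  define \<delta> where "\<delta> = join_path \<alpha> \<beta>"
  have \<delta>: "lip_path m \<delta>"
    unfolding \<delta>_def using \<alpha> \<beta> by (intro lip_path_join) auto
  define \<phi> where "\<phi> = (\<lambda>s. linepath 0 ((1 + s) / 2) :: real \<Rightarrow> real)"
  define \<Gamma> where "\<Gamma> = (\<lambda>s. homotopy_class m (\<delta> \<circ> \<phi> s))"
  have \<phi>: "lip_path unit_interval (\<phi> s)" if "s \<in> {0..1}" for s
    unfolding \<phi>_def using that by (intro lip_path_linepath) auto
  have \<phi>01: "\<phi> s 0 = 0" "\<phi> s 1 = (1 + s) / 2" for s
    by (simp_all add: \<phi>_def linepath_0' linepath_1')
  have \<delta>\<phi>: "lip_path m (\<delta> \<circ> \<phi> s)" "(\<delta> \<circ> \<phi> s) 0 = p" if "s \<in> {0..1}" for s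
    using lip_path_compose[OF \<delta> \<phi>] that \<alpha> by (auto simp: \<phi>01 \<delta>_def)
  have "mdist ?P (\<Gamma> a) (\<Gamma> b) \<le> variation m \<beta> a b" if ab: "0 \<le> a" "a \<le> b" "b \<le> 1" for a b
  proof -
    have I: "a \<in> {0..1}" "b \<in> {0..1}"
      using ab by auto
    \<comment> \<open>Going from \<open>(1 + a) / 2\<close> down to \<open>0\<close> and up to \<open>(1 + b) / 2\<close> is deformed to going there directly.\<close>
    have "lip_homotopic m (\<beta> \<circ> linepath a b) (join_path (rev_path (\<delta> \<circ> \<phi> a)) (\<delta> \<circ> \<phi> b))"
      unfolding join_rev_compose
    proof (rule lip_homotopic_reparam[OF \<delta>])
      show "lip_path unit_interval (linepath ((1 + a) / 2) ((1 + b) / 2))"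
        using ab by (intro lip_path_linepath) auto
      show "lip_path unit_interval (join_path (rev_path (\<phi> a)) (\<phi> b))"
        using I by (intro lip_path_join lip_path_rev \<phi>) (auto simp: \<phi>01)
      show "(\<beta> \<circ> linepath a b) s = \<delta> (linepath ((1 + a) / 2) ((1 + b) / 2) s)"
        if s: "s \<in> {0..1}" for s
      proof -
        have "linepath ((1 + a) / 2) ((1 + b) / 2) s = (1 + linepath a b s) / 2"
          by (simp add: linepath_def field_simps)
        moreover have "linepath a b s \<in> {0..1}"
          using lip_path_in_mspace[OF lip_path_linepath[OF I] s] by simp
        ultimately show ?thesis
          using join_path_second_half[of "linepath a b s" \<alpha> \<beta>] \<beta> unfolding \<delta>_def o_def by metis
      qed
    qed (simp_all add: \<phi>01 linepath_0' linepath_1')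
    then have "path_space_dist m p (\<Gamma> a) (\<Gamma> b) \<le> path_length m (\<beta> \<circ> linepath a b)"
      unfolding \<Gamma>_def using \<delta>\<phi> I by (intro path_space_dist_le) auto
    also have "\<dots> \<le> variation m \<beta> a b"
      by (rule path_length_restriction_le_variation[OF \<beta>(1) ab])
    finally show ?thesis
      by (simp add: mdistP)
  qed
  moreover have "\<Gamma> s \<in> mspace ?P" if "s \<in> {0..1}" for s
    unfolding \<Gamma>_def mspaceP using \<delta>\<phi>[OF that] by (intro homotopy_class_in_path_space)
  ultimately have "lip_path ?P \<Gamma>" "path_length ?P \<Gamma> \<le> path_length m \<beta>"
    using path_dominated_by_variation[OF \<beta>(1), of \<Gamma> ?P] by blast+
  moreover have "\<Gamma> 0 = homotopy_class m \<alpha>"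
    unfolding \<Gamma>_def
  proof (intro homotopy_class_eq lip_homotopic_reparam[OF \<alpha>(1) lip_path_id lip_path_id])
    show "(\<delta> \<circ> \<phi> 0) s = \<alpha> s" if "s \<in> {0..1}" for s
      using join_path_first_half[OF that, of \<alpha> \<beta>] by (simp add: \<delta>_def \<phi>_def linepath_def)
  qed auto
  moreover have "\<Gamma> 1 = homotopy_class m (join_path \<alpha> \<beta>)"
  proof -
    have "\<delta> \<circ> \<phi> 1 = \<delta>"
      by (auto simp: \<phi>_def linepath_def)
    then show ?thesis
      by (simp add: \<Gamma>_def \<delta>_def)
  qed
  ultimately show ?thesis
    using that by blast
qed

theorem theorem3p10:
  fixes M :: "'a metric" and p\<^sub>0 :: 'a
  assumes "p\<^sub>0 \<in> mspace M"
    and "lip_path_connected M"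
    and "\<exists>x\<in>mspace M. \<exists>y\<in>mspace M. x \<noteq> y"
    and "Metric_space (path_space M p\<^sub>0) (path_space_dist M p\<^sub>0)"
  shows "length_space (metric (path_space M p\<^sub>0, path_space_dist M p\<^sub>0))"
proof -
  let ?P = "metric (path_space M p\<^sub>0, path_space_dist M p\<^sub>0)"
  have mdistP: "mdist ?P = path_space_dist M p\<^sub>0" and mspaceP: "mspace ?P = path_space M p\<^sub>0"
    using Metric_space.mdist_metric[OF assms(4)] Metric_space.mspace_metric[OF assms(4)] by auto
  have "\<exists>\<Gamma>. lip_path ?P \<Gamma> \<and> \<Gamma> 0 = x \<and> \<Gamma> 1 = y \<and> path_length ?P \<Gamma> \<le> C * mdist ?P x y"
    if "C > 1" and xy: "x \<in> mspace ?P" "y \<in> mspace ?P" for C x y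
  proof (cases "x = y")
    case True
    have "lip_path ?P (\<lambda>_. x)"
      using xy by (simp add: lip_path_def Lipschitz_continuous_map_const)
    moreover have "mdist ?P x x = 0"
      using xy by simp
    moreover from this have "partition_sums ?P (\<lambda>_. x) 0 1 \<subseteq> {0}"
      by (auto simp: partition_sums_def)
    then have "path_length ?P (\<lambda>_. x) = 0"
      using partition_sums_nonempty[of 0 1 ?P "\<lambda>_. x"]
      by (auto simp: path_length_eq_variation variation_def subset_singleton_iff)
    ultimately show ?thesis
      using True by fastforce
  next
    case False
    then have "mdist ?P x y > 0"
      using xy by (metis mdist_nonneg mdist_zero order_le_less)
    then have "path_space_dist M p\<^sub>0 x y < C * mdist ?P x y"
      using \<open>C > 1\<close> by (simp add: mdistP)
    then obtain \<beta> \<gamma>\<^sub>1 \<gamma>\<^sub>2 where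
      \<gamma>\<^sub>1: "lip_path M \<gamma>\<^sub>1" "\<gamma>\<^sub>1 0 = p\<^sub>0" "x = homotopy_class M \<gamma>\<^sub>1" and
      \<gamma>\<^sub>2: "lip_path M \<gamma>\<^sub>2" "\<gamma>\<^sub>2 0 = p\<^sub>0" "y = homotopy_class M \<gamma>\<^sub>2" and
      \<beta>: "lip_homotopic M \<beta> (join_path (rev_path \<gamma>\<^sub>1) \<gamma>\<^sub>2)" "path_length M \<beta> < C * mdist ?P x y"
      by (rule path_space_dist_approx[OF xy[unfolded mspaceP]])
    have \<beta>0: "lip_path M \<beta>" "\<gamma>\<^sub>1 1 = \<beta> 0"
      using \<beta>(1) by (simp_all add: lip_homotopic_def)
    obtain \<Gamma> where \<Gamma>: "lip_path ?P \<Gamma>" "\<Gamma> 0 = x" "\<Gamma> 1 = homotopy_class M (join_path \<gamma>\<^sub>1 \<beta>)"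
      "path_length ?P \<Gamma> \<le> path_length M \<beta>"
      using lift_path[OF \<gamma>\<^sub>1(1,2) \<beta>0 assms(4)] \<gamma>\<^sub>1(3) by metis
    have "lip_homotopic M (join_path \<gamma>\<^sub>1 \<beta>) (join_path \<gamma>\<^sub>1 (join_path (rev_path \<gamma>\<^sub>1) \<gamma>\<^sub>2))"
      using \<gamma>\<^sub>1 \<beta>0 \<beta>(1) by (intro lip_homotopic_join_right) auto
    also have "lip_homotopic M \<dots> \<gamma>\<^sub>2"
      using \<gamma>\<^sub>1 \<gamma>\<^sub>2 by (intro lip_homotopic_join_join_rev) auto
    finally have "\<Gamma> 1 = y"
      using \<Gamma>(3) \<gamma>\<^sub>2(3) homotopy_class_eq by metis
    then show ?thesis
      using \<Gamma> \<beta>(2) by (intro exI[of _ \<Gamma>]) auto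
  qed
  then show ?thesis
    unfolding length_space_def by blast
qed

end
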